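(* Let $(H,\Delta,\epsilon,\Phi,S,\alpha,\beta)$ be a quasi-triangular quasi-Hopf algebra with bijective antipode and $R$-matrix $\mathcal{R}$, let $\tilde{\mathcal{R}}=(\mathcal{R}^T)^{-1}$, and let $u$ and $\tilde u$ be the $u$-operators associated with $\mathcal{R}$ and $\tilde{\mathcal{R}}$ respectively. Then $u$ and $\tilde u$ are invariant under twisting: for every twist $F\in H\otimes H$, the operators $u$ and $\tilde u$ formed from the twisted quasi-triangular quasi-Hopf algebra $(H,\Delta_F,\epsilon,\Phi_F,S,\alpha_F,\beta_F)$ with $R$-matrix $\mathcal{R}_F=F^T\mathcal{R}F^{-1}$ (and $((\mathcal{R}_F)^T)^{-1}$ for $\tilde u$) coincide with $u$ and $\tilde u$ respectively.
   Context: A quasi-bialgebra $(H,\Delta,\epsilon,\Phi)$ over a field $k$ is a unital associative $k$-algebra $H$ with algebra homomorphisms $\epsilon:H\to k$, $\Delta:H\to H\otimes H$ and an invertible $\Phi\in H\otimes H\otimes H$ such that (with $1$ also denoting the identity map) $(1\otimes\Delta)\Delta(a)=\Phi^{-1}(\Delta\otimes 1)\Delta(a)\Phi$ for all $a\in H$; $(\Delta\otimes 1\otimes 1)\Phi\cdot(1\otimes 1\otimes\Delta)\Phi=(\Phi\otimes 1)\cdot(1\otimes\Delta\otimes 1)\Phi\cdot(1\otimes\Phi)$; $(\epsilon\otimes 1)\Delta=1=(1\otimes\epsilon)\Delta$; $(1\otimes\epsilon\otimes 1)\Phi=1$. Write $\Phi=\sum_\nu X_\nu\otimes Y_\nu\otimes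 Z_\nu$, $\Phi^{-1}=\sum_\nu\bar X_\nu\otimes\bar Y_\nu\otimes\bar Z_\nu$, $\Delta(a)=\sum a_{(1)}\otimes a_{(2)}$. A quasi-Hopf algebra $(H,\Delta,\epsilon,\Phi,S,\alpha,\beta)$ is a quasi-bialgebra with an algebra anti-homomorphism $S:H\to H$ (assumed bijective) and $\alpha,\beta\in H$ such that $\sum S(X_\nu)\alpha Y_\nu\beta S(Z_\nu)=1=\sum\bar X_\nu\beta S(\bar Y_\nu)\alpha\bar Z_\nu$ and $\sum S(a_{(1)})\alpha a_{(2)}=\epsilon(a)\alpha$, $\sum a_{(1)}\beta S(a_{(2)})=\epsilon(a)\beta$ for all $a\in H$. It is quasi-triangular if there is an invertible $\mathcal{R}=\sum e_i\otimes e^i\in H\otimes H$ (the $R$-matrix) with $\Delta^T(a)\mathcal{R}=\mathcal{R}\Delta(a)$ for all $a$, $(\Delta\otimes 1)\mathcal{R}=\Phi_{231}^{-1}\mathcal{R}_{13}\Phi_{132}\mathcal{R}_{23}\Phi_{123}^{-1}$, $(1\otimes\Delta)\mathcal{R}=\Phi_{312}\mathcal{R}_{13}\Phi_{213}^{-1}\mathcal{R}_{12}\Phi_{123}$. Here $\Delta^T=T\circ\Delta$, $F^T=T(F)$ with $T$ the flip, $\mathcal{R}_{12}=\sum e_i\otimes e^i\otimes 1$, $\mathcal{R}_{13}=\sum e_i\otimes 1\otimes e^i$, $\mathcal{R}_{23}=\sum 1\otimes e_i\otimes e^i$, and $\Phi_{123}=\Phi$, $\Phi_{132}=\sum X_\nu\otimes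 Z_\nu\otimes Y_\nu$, $\Phi_{213}=\sum Y_\nu\otimes X_\nu\otimes Z_\nu$, $\Phi_{231}=\sum Y_\nu\otimes Z_\nu\otimes X_\nu$, $\Phi_{312}=\sum Z_\nu\otimes X_\nu\otimes Y_\nu$. The element $(\mathcal{R}^T)^{-1}$ is also an $R$-matrix for $H$. A twist is an invertible $F\in H\otimes H$ with $(\epsilon\otimes 1)F=(1\otimes\epsilon)F=1$. With $F=\sum f_i\otimes f^i$, $F^{-1}=\sum\bar f_i\otimes\bar f^i$, the structure twisted by $F$ has the same $\epsilon$ and $S$, and $\Delta_F(a)=F\Delta(a)F^{-1}$, $\Phi_F=(F\otimes 1)\cdot(\Delta\otimes 1)F\cdot\Phi\cdot(1\otimes\Delta)F^{-1}\cdot(1\otimes F^{-1})$, $\alpha_F=\sum S(\bar f_i)\alpha\bar f^i$, $\beta_F=\sum f_i\beta S(f^i)$, and $R$-matrix $\mathcal{R}_F=F^T\mathcal{R}F^{-1}$. For a quasi-Hopf algebra with an $R$-matrix $Q=\sum q_i\otimes q^i$, $Q^{-1}=\sum\bar q_i\otimes\bar q^i$, set $\alpha_Q=\sum S(\bar q_i)\alpha\bar q^i$, $\beta_Q=\sum q_i\beta S(q^i)$. The $u$-operator associated with $Q$ is the unique invertible $u_Q\in H$ with $S^2(a)=u_Q a u_Q^{-1}$ for all $a\in H$, $u_Q S^{-1}(\alpha)=\alpha_Q$, $\beta_Q u_Q=S^{-1}(\beta)$; explicitly $u_Q=\sum S(Y_\nu\beta S(Z_\nu))\alpha_Q X_\nu$.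 Here $u=u_{\mathcal{R}}$ and $\tilde u=u_{\tilde{\mathcal{R}}}$. *)

theory Defs
  imports Complex_Main "HOL-Library.Poly_Mapping"
begin

section \<open>Algebras over a field and their tensor powers\<close>

text \<open>
  The algebra \<open>H\<close> is a type of class \<^class>\<open>ring_1\<close>; the action of the field on it is a record
  field.  The only thing \<^class>\<open>ring_1\<close> adds to ``unital associative ring'' is \<open>0 \<noteq> 1\<close>, which
  the existence of a (unital) counit forces anyway.
\<close>

record ('k, 'h) kalg =
  scal :: "'k \<Rightarrow> 'h \<Rightarrow> 'h"

locale k_algebra = vector_space "scal H"
  for H :: "('k::field, 'h::ring_1, 'z) kalg_scheme" (structure) +
  assumes scal_mult_left: "scal H c (a * b) = scal H c a * b"
    and scal_mult_right: "scal H c (a * b) = a * scal H c b"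

text \<open>
  All tensor powers are built at once.  A word \<open>[a\<^sub>1, \<dots>, a\<^sub>n]\<close> stands for
  \<open>a\<^sub>1 \<otimes> \<dots> \<otimes> a\<^sub>n\<close>; the direct sum of the \<open>n\<close>-fold tensor powers over all \<open>n\<close> is the free
  vector space on words modulo the multilinearity relations, its elements being cosets.
  The \<open>n\<close>-fold tensor power is the image of the combinations of words of length \<open>n\<close>; for
  \<open>n = 0\<close> this is the ground field, \<open>c\<close> being identified with \<open>c\<close> times the empty word.
\<close>

type_synonym ('k, 'h) formal = "'h list \<Rightarrow>\<^sub>0 'k"
type_synonym ('k, 'h) tensor = "('k, 'h) formal set"

definition fscale :: "'k::field \<Rightarrow> ('k, 'h) formal \<Rightarrow> ('k, 'h) formal" where
  "fscale c p = Poly_Mapping.map ((*) c) p"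

definition relators :: "('k::field, 'h::ring_1, 'z) kalg_scheme \<Rightarrow> ('k, 'h) formal set" where
  "relators H =
     {Poly_Mapping.single (xs @ (a + b) # ys) 1
        - Poly_Mapping.single (xs @ a # ys) 1 - Poly_Mapping.single (xs @ b # ys) 1
      | xs a b ys. True} \<union>
     {Poly_Mapping.single (xs @ scal H c a # ys) 1 - Poly_Mapping.single (xs @ a # ys) c
      | xs c a ys. True}"

definition tnull :: "('k::field, 'h::ring_1, 'z) kalg_scheme \<Rightarrow> ('k, 'h) formal set" where
  "tnull H = module.span fscale (relators H)"

definition tclass ::
    "('k::field, 'h::ring_1, 'z) kalg_scheme \<Rightarrow> ('k, 'h) formal \<Rightarrow> ('k, 'h) tensor" where
  "tclass H p = {q. q - p \<in> tnull H}"

definition tpow :: "('k::field, 'h::ring_1, 'z) kalg_scheme \<Rightarrow> nat \<Rightarrow> ('k, 'h) tensor set" where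
  "tpow H n = tclass H ` {p. \<forall>xs \<in> Poly_Mapping.keys p. length xs = n}"

definition trep :: "('k::field, 'h) tensor \<Rightarrow> ('k, 'h) formal" where
  "trep t = (SOME p. p \<in> t)"

definition pure ::
    "('k::field, 'h::ring_1, 'z) kalg_scheme \<Rightarrow> 'h list \<Rightarrow> ('k, 'h) tensor" where
  "pure H xs = tclass H (Poly_Mapping.single xs 1)"

definition tzero :: "('k::field, 'h::ring_1, 'z) kalg_scheme \<Rightarrow> ('k, 'h) tensor" where
  "tzero H = tclass H 0"

definition tadd ::
    "('k::field, 'h::ring_1, 'z) kalg_scheme \<Rightarrow> ('k, 'h) tensor \<Rightarrow> ('k, 'h) tensor \<Rightarrow> ('k, 'h) tensor"
    (infixl "\<oplus>\<index>" 65) where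
  "tadd H s t = tclass H (trep s + trep t)"

definition tscale ::
    "('k::field, 'h::ring_1, 'z) kalg_scheme \<Rightarrow> 'k \<Rightarrow> ('k, 'h) tensor \<Rightarrow> ('k, 'h) tensor" where
  "tscale H c t = tclass H (fscale c (trep t))"

text \<open>
  Linear extension of a function on words, with values in tensors (\<open>tlift\<close>) or in \<open>H\<close>
  (\<open>teval\<close>).  It is independent of the representative chosen by \<^const>\<open>trep\<close> as soon as the
  function is additive and homogeneous in every letter of words of every length (see
  \<open>tlift_tclass\<close> and \<open>teval_tclass\<close> below); the functions used here are, because they vanish on
  words of the wrong length.
\<close>

definition tlift ::
    "('k::field, 'h::ring_1, 'z) kalg_scheme \<Rightarrow> ('h list \<Rightarrow> ('k, 'h) tensor)
      \<Rightarrow> ('k, 'h) tensor \<Rightarrow> ('k, 'h) tensor" where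
  "tlift H w t = tclass H
     (\<Sum>xs \<in> Poly_Mapping.keys (trep t). fscale (Poly_Mapping.lookup (trep t) xs) (trep (w xs)))"

definition teval ::
    "('k::field, 'h::ring_1, 'z) kalg_scheme \<Rightarrow> ('h list \<Rightarrow> 'h) \<Rightarrow> ('k, 'h) tensor \<Rightarrow> 'h" where
  "teval H g t =
     (\<Sum>xs \<in> Poly_Mapping.keys (trep t). scal H (Poly_Mapping.lookup (trep t) xs) (g xs))"

lemma lookup_fscale [simp]: "Poly_Mapping.lookup (fscale c p) x = c * Poly_Mapping.lookup p x"
  unfolding fscale_def by (simp add: Poly_Mapping.map.rep_eq when_def)

interpretation fs: vector_space "fscale :: 'k::field \<Rightarrow> _"
  by unfold_locales (auto intro!: poly_mapping_eqI simp: lookup_add algebra_simps)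

lemma trep_tclass: "trep (tclass H p) - p \<in> tnull H"
proof -
  have "p \<in> tclass H p" by (simp add: tclass_def tnull_def fs.span_zero)
  then have "trep (tclass H p) \<in> tclass H p" unfolding trep_def by (rule someI)
  then show ?thesis by (simp add: tclass_def)
qed

lemma tclass_eq_iff: "tclass H p = tclass H q \<longleftrightarrow> p - q \<in> tnull H"
proof
  assume "tclass H p = tclass H q"
  moreover have "p \<in> tclass H p" by (simp add: tclass_def tnull_def fs.span_zero)
  ultimately show "p - q \<in> tnull H" by (simp add: tclass_def)
next
  assume a: "p - q \<in> tnull H"
  have "r - p \<in> tnull H \<longleftrightarrow> r - q \<in> tnull H" for r
  proof
    assume "r - p \<in> tnull H" from fs.span_add[OF this[unfolded tnull_def] a[unfolded tnull_def]]
    show "r - q \<in> tnull H" by (simp add: tnull_def)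
  next
    assume "r - q \<in> tnull H" from fs.span_diff[OF this[unfolded tnull_def] a[unfolded tnull_def]]
    show "r - p \<in> tnull H" by (simp add: tnull_def)
  qed
  then show "tclass H p = tclass H q" by (simp add: tclass_def)
qed

definition lext :: "('k::field \<Rightarrow> 'b::ab_group_add \<Rightarrow> 'b) \<Rightarrow> ('h list \<Rightarrow> 'b) \<Rightarrow> ('k, 'h) formal \<Rightarrow> 'b" where
  "lext sc f p = (\<Sum>xs \<in> Poly_Mapping.keys p. sc (Poly_Mapping.lookup p xs) (f xs))"

lemma lext_superset:
  assumes "vector_space sc" "finite A" "Poly_Mapping.keys p \<subseteq> A"
  shows "lext sc f p = (\<Sum>xs \<in> A. sc (Poly_Mapping.lookup p xs) (f xs))"
proof -
  interpret vector_space sc by fact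
  show ?thesis unfolding lext_def
    by (rule sum.mono_neutral_left) (use assms in \<open>auto simp: in_keys_iff\<close>)
qed

lemma lext_hom:
  assumes "vector_space sc"
  shows "lext sc f (p + q) = lext sc f p + lext sc f q"
    and "lext sc f (fscale c p) = sc c (lext sc f p)"
    and "lext sc f (p - q) = lext sc f p - lext sc f q"
    and "lext sc f (Poly_Mapping.single xs c) = sc c (f xs)"
    and "lext sc f 0 = 0"
proof -
  interpret vector_space sc by fact
  let ?A = "Poly_Mapping.keys p \<union> Poly_Mapping.keys q"
  note S = lext_superset[OF assms, of ?A]
  have k: "Poly_Mapping.keys (p + q) \<subseteq> ?A" "Poly_Mapping.keys (fscale c p) \<subseteq> ?A"
     "Poly_Mapping.keys (p - q) \<subseteq> ?A"
    by (auto simp: in_keys_iff lookup_add lookup_minus)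
  show "lext sc f (p + q) = lext sc f p + lext sc f q"
    using k by (subst (1 2 3) S) (auto simp: lookup_add scale_left_distrib sum.distrib)
  show "lext sc f (p - q) = lext sc f p - lext sc f q"
    using k by (subst (1 2 3) S) (auto simp: lookup_minus scale_left_diff_distrib sum_subtractf)
  show "lext sc f (fscale c p) = sc c (lext sc f p)"
    using k by (subst (1 2) S) (auto simp: scale_sum_right)
  show "lext sc f (Poly_Mapping.single xs c) = sc c (f xs)"
    by (subst lext_superset[OF assms, of "{xs}"]) auto
  show "lext sc f 0 = 0" by (simp add: lext_def)
qed

lemma teval_tclass:
  assumes "vector_space (scal H)"
    and "\<And>xs a b ys. g (xs @ (a + b) # ys) = g (xs @ a # ys) + g (xs @ b # ys)"
    and "\<And>xs c a ys. g (xs @ scal H c a # ys) = scal H c (g (xs @ a # ys))"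
  shows "teval H g (tclass H p) =
    (\<Sum>xs \<in> Poly_Mapping.keys p. scal H (Poly_Mapping.lookup p xs) (g xs))"
proof -
  interpret vector_space "scal H" by fact
  note L = lext_hom[OF assms(1)]
  have "lext (scal H) g q = 0" if "q \<in> tnull H" for q
    using that unfolding tnull_def
  proof (induction rule: fs.span_induct_alt)
    case base show ?case by (simp add: L)
  next
    case (step c x y)
    have "lext (scal H) g x = 0"
      using step(1) assms(2,3) unfolding relators_def by (auto simp: L)
    then show ?case using step by (simp add: L)
  qed
  from this[OF trep_tclass[of H p]] show ?thesis by (simp add: L lext_def[symmetric] teval_def)
qed

lemma tlift_tclass:
  assumes "\<And>xs a b ys. w (xs @ (a + b) # ys) = w (xs @ a # ys) \<oplus>\<^bsub>H\<^esub> w (xs @ b # ys)"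
    and "\<And>xs c a ys. w (xs @ scal H c a # ys) = tscale H c (w (xs @ a # ys))"
  shows "tlift H w (tclass H p) = tclass H
    (\<Sum>xs \<in> Poly_Mapping.keys p. fscale (Poly_Mapping.lookup p xs) (trep (w xs)))"
proof -
  note L = lext_hom[OF fs.vector_space_axioms]
  let ?L = "lext fscale (\<lambda>xs. trep (w xs))"
  have "?L q \<in> tnull H" if "q \<in> tnull H" for q
    using that unfolding tnull_def
  proof (induction rule: fs.span_induct_alt)
    case base show ?case by (simp add: L fs.span_zero)
  next
    case (step c x y)
    from step(1) consider
        (add) xs a b ys where "x = Poly_Mapping.single (xs @ (a + b) # ys) 1
          - Poly_Mapping.single (xs @ a # ys) 1 - Poly_Mapping.single (xs @ b # ys) 1"
      | (scale) xs c a ys where "x = Poly_Mapping.single (xs @ scal H c a # ys) 1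
          - Poly_Mapping.single (xs @ a # ys) c"
      unfolding relators_def by blast
    then have "?L x \<in> tnull H"
    proof cases
      case (add xs a b ys)
      then show ?thesis
        using trep_tclass[of H "trep (w (xs @ a # ys)) + trep (w (xs @ b # ys))"]
        by (simp add: L assms(1) tadd_def diff_diff_eq)
    next
      case (scale xs c a ys)
      then show ?thesis
        using trep_tclass[of H "fscale c (trep (w (xs @ a # ys)))"]
        by (simp add: L assms(2) tscale_def)
    qed
    then show ?case using step unfolding tnull_def by (simp add: L fs.span_add fs.span_scale)
  qed
  from this[OF trep_tclass[of H p]] show ?thesis
    by (simp add: L tlift_def tclass_eq_iff) (simp add: lext_def)
qed

text \<open>In particular, \<open>H\<close> embeds into its first tensor power.\<close>

lemma pure_singleton_inj:
  assumes "vector_space (scal H)" "pure H [a] = pure H [b]" shows "a = b"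
proof -
  interpret vector_space "scal H" by fact
  let ?g = "\<lambda>xs. case xs of [x] \<Rightarrow> x | _ \<Rightarrow> 0"
  have "teval H ?g (pure H [x]) = x" for x
    unfolding pure_def
    by (subst teval_tclass[OF assms(1)])
       (auto split: list.splits simp: append_eq_Cons_conv Cons_eq_append_conv)
  then show ?thesis using assms(2) by metis
qed

definition tcat ::
    "('k::field, 'h::ring_1, 'z) kalg_scheme \<Rightarrow> ('k, 'h) tensor \<Rightarrow> ('k, 'h) tensor \<Rightarrow> ('k, 'h) tensor"
    (infixr "\<otimes>\<index>" 75) where
  "tcat H s t = tlift H (\<lambda>xs. tlift H (\<lambda>ys. pure H (xs @ ys)) t) s"

text \<open>The product of the algebra \<open>H \<otimes> \<dots> \<otimes> H\<close>.\<close>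

definition tmul ::
    "('k::field, 'h::ring_1, 'z) kalg_scheme \<Rightarrow> ('k, 'h) tensor \<Rightarrow> ('k, 'h) tensor \<Rightarrow> ('k, 'h) tensor"
    (infixl "\<odot>\<index>" 70) where
  "tmul H s t = tlift H (\<lambda>xs. tlift H (\<lambda>ys.
      if length xs = length ys then pure H (map2 (*) xs ys) else tzero H) t) s"

definition tone :: "('k::field, 'h::ring_1, 'z) kalg_scheme \<Rightarrow> nat \<Rightarrow> ('k, 'h) tensor" where
  "tone H n = pure H (replicate n 1)"

definition is_tinverse ::
    "('k::field, 'h::ring_1, 'z) kalg_scheme \<Rightarrow> nat \<Rightarrow> ('k, 'h) tensor \<Rightarrow> ('k, 'h) tensor \<Rightarrow> bool" where
  "is_tinverse H n t s \<longleftrightarrow> s \<in> tpow H n \<and> tmul H t s = tone H n \<and> tmul H s t = tone H n"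

definition tinvertible ::
    "('k::field, 'h::ring_1, 'z) kalg_scheme \<Rightarrow> nat \<Rightarrow> ('k, 'h) tensor \<Rightarrow> bool" where
  "tinvertible H n t \<longleftrightarrow> t \<in> tpow H n \<and> (\<exists>s. is_tinverse H n t s)"

definition tinv ::
    "('k::field, 'h::ring_1, 'z) kalg_scheme \<Rightarrow> nat \<Rightarrow> ('k, 'h) tensor \<Rightarrow> ('k, 'h) tensor" where
  "tinv H n t = (THE s. is_tinverse H n t s)"

text \<open>
  \<open>tmaps H [f\<^sub>1, \<dots>, f\<^sub>n]\<close> is the map \<open>f\<^sub>1 \<otimes> \<dots> \<otimes> f\<^sub>n\<close> on the \<open>n\<close>-fold tensor power.
\<close>

definition tmaps ::
    "('k::field, 'h::ring_1, 'z) kalg_scheme \<Rightarrow> ('h \<Rightarrow> ('k, 'h) tensor) list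
      \<Rightarrow> ('k, 'h) tensor \<Rightarrow> ('k, 'h) tensor" where
  "tmaps H fs = tlift H (\<lambda>xs. if length xs = length fs
      then foldr (tcat H) (map2 (\<lambda>f x. f x) fs xs) (pure H []) else tzero H)"

definition idt :: "('k::field, 'h::ring_1, 'z) kalg_scheme \<Rightarrow> 'h \<Rightarrow> ('k, 'h) tensor" where
  "idt H a = pure H [a]"

text \<open>\<open>legs2 H w\<close> sends \<open>\<Sum> x \<otimes> y\<close> to \<open>\<Sum> w x y\<close>, where \<open>w x y\<close> is again a word; similarly for
  \<open>legs3\<close>, and for \<open>teval2\<close>, \<open>teval3\<close> with values in \<open>H\<close>.\<close>

definition legs2 ::
    "('k::field, 'h::ring_1, 'z) kalg_scheme \<Rightarrow> ('h \<Rightarrow> 'h \<Rightarrow> 'h list)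
      \<Rightarrow> ('k, 'h) tensor \<Rightarrow> ('k, 'h) tensor" where
  "legs2 H w = tlift H (\<lambda>xs. case xs of [x, y] \<Rightarrow> pure H (w x y) | _ \<Rightarrow> tzero H)"

definition legs3 ::
    "('k::field, 'h::ring_1, 'z) kalg_scheme \<Rightarrow> ('h \<Rightarrow> 'h \<Rightarrow> 'h \<Rightarrow> 'h list)
      \<Rightarrow> ('k, 'h) tensor \<Rightarrow> ('k, 'h) tensor" where
  "legs3 H w = tlift H (\<lambda>xs. case xs of [x, y, z] \<Rightarrow> pure H (w x y z) | _ \<Rightarrow> tzero H)"

definition teval2 ::
    "('k::field, 'h::ring_1, 'z) kalg_scheme \<Rightarrow> ('h \<Rightarrow> 'h \<Rightarrow> 'h) \<Rightarrow> ('k, 'h) tensor \<Rightarrow> 'h" where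
  "teval2 H g = teval H (\<lambda>xs. case xs of [x, y] \<Rightarrow> g x y | _ \<Rightarrow> 0)"

definition teval3 ::
    "('k::field, 'h::ring_1, 'z) kalg_scheme \<Rightarrow> ('h \<Rightarrow> 'h \<Rightarrow> 'h \<Rightarrow> 'h) \<Rightarrow> ('k, 'h) tensor \<Rightarrow> 'h" where
  "teval3 H g = teval H (\<lambda>xs. case xs of [x, y, z] \<Rightarrow> g x y z | _ \<Rightarrow> 0)"

definition flip ::
    "('k::field, 'h::ring_1, 'z) kalg_scheme \<Rightarrow> ('k, 'h) tensor \<Rightarrow> ('k, 'h) tensor" where
  "flip H = legs2 H (\<lambda>x y. [y, x])"


section \<open>Quasi-bialgebras and quasi-Hopf algebras\<close>

record (overloaded) ('k, 'h) quasi_bialg = "('k, 'h) kalg" +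
  comul :: "'h \<Rightarrow> ('k, 'h) tensor" ("\<Delta>\<index>")
  counit :: "'h \<Rightarrow> 'k" ("\<epsilon>\<index>")
  assoc :: "('k, 'h) tensor" ("\<Phi>\<index>")

record (overloaded) ('k, 'h) quasi_hopf = "('k, 'h) quasi_bialg" +
  antipode :: "'h \<Rightarrow> 'h" ("\<S>\<index>")
  alpha :: "'h" ("\<alpha>\<index>")
  beta :: "'h" ("\<beta>\<index>")

text \<open>The counit as a map into the \<open>0\<close>-fold tensor power.\<close>

definition epst ::
    "('k::field, 'h::ring_1, 'z) quasi_bialg_scheme \<Rightarrow> 'h \<Rightarrow> ('k, 'h) tensor" where
  "epst H a = tscale H (counit H a) (pure H [])"

locale quasi_bialgebra = k_algebra H
  for H :: "('k::field, 'h::ring_1, 'z) quasi_bialg_scheme" (structure) +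
  assumes counit_linear: "Vector_Spaces.linear (scal H) (*) \<epsilon>"
    and counit_mult: "\<epsilon> (a * b) = \<epsilon> a * \<epsilon> b"
    and counit_one: "\<epsilon> 1 = 1"
    and comul_closed: "\<Delta> a \<in> tpow H 2"
    and comul_add: "\<Delta> (a + b) = \<Delta> a \<oplus> \<Delta> b"
    and comul_scal: "\<Delta> (scal H c a) = tscale H c (\<Delta> a)"
    and comul_mult: "\<Delta> (a * b) = \<Delta> a \<odot> \<Delta> b"
    and comul_one: "\<Delta> 1 = tone H 2"
    and assoc_invertible: "tinvertible H 3 \<Phi>"
    and quasi_coassoc:
      "tmaps H [idt H, \<Delta>] (\<Delta> a) = tinv H 3 \<Phi> \<odot> tmaps H [\<Delta>, idt H] (\<Delta> a) \<odot> \<Phi>"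
    and pentagon:
      "tmaps H [\<Delta>, idt H, idt H] \<Phi> \<odot> tmaps H [idt H, idt H, \<Delta>] \<Phi> =
         (\<Phi> \<otimes> tone H 1) \<odot> tmaps H [idt H, \<Delta>, idt H] \<Phi> \<odot> (tone H 1 \<otimes> \<Phi>)"
    and counit_left: "tmaps H [epst H, idt H] (\<Delta> a) = idt H a"
    and counit_right: "tmaps H [idt H, epst H] (\<Delta> a) = idt H a"
    and counit_assoc: "tmaps H [idt H, epst H, idt H] \<Phi> = tone H 2"

locale quasi_hopf_algebra = quasi_bialgebra H
  for H :: "('k::field, 'h::ring_1, 'z) quasi_hopf_scheme" (structure) +
  assumes antipode_linear: "Vector_Spaces.linear (scal H) (scal H) \<S>"
    and antipode_mult: "\<S> (a * b) = \<S> b * \<S> a"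
    and antipode_one: "\<S> 1 = 1"
    and antipode_bij: "bij \<S>"
    and antipode_assoc: "teval3 H (\<lambda>x y z. \<S> x * \<alpha> * y * \<beta> * \<S> z) \<Phi> = 1"
    and antipode_assoc_inv: "teval3 H (\<lambda>x y z. x * \<beta> * \<S> y * \<alpha> * z) (tinv H 3 \<Phi>) = 1"
    and antipode_left: "teval2 H (\<lambda>x y. \<S> x * \<alpha> * y) (\<Delta> a) = scal H (\<epsilon> a) \<alpha>"
    and antipode_right: "teval2 H (\<lambda>x y. x * \<beta> * \<S> y) (\<Delta> a) = scal H (\<epsilon> a) \<beta>"

locale quasi_triangular_quasi_hopf_algebra = quasi_hopf_algebra H
  for H :: "('k::field, 'h::ring_1, 'z) quasi_hopf_scheme" (structure) +
  fixes R :: "('k, 'h) tensor"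
  assumes R_invertible: "tinvertible H 2 R"
    and R_comul: "flip H (\<Delta> a) \<odot> R = R \<odot> \<Delta> a"
    and R_hexagon_left:
      "tmaps H [\<Delta>, idt H] R =
         tinv H 3 (legs3 H (\<lambda>x y z. [y, z, x]) \<Phi>) \<odot> legs2 H (\<lambda>x y. [x, 1, y]) R
         \<odot> legs3 H (\<lambda>x y z. [x, z, y]) \<Phi> \<odot> legs2 H (\<lambda>x y. [1, x, y]) R
         \<odot> tinv H 3 \<Phi>"
    and R_hexagon_right:
      "tmaps H [idt H, \<Delta>] R =
         legs3 H (\<lambda>x y z. [z, x, y]) \<Phi> \<odot> legs2 H (\<lambda>x y. [x, 1, y]) R
         \<odot> tinv H 3 (legs3 H (\<lambda>x y z. [y, x, z]) \<Phi>) \<odot> legs2 H (\<lambda>x y. [x, y, 1]) R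
         \<odot> \<Phi>"


section \<open>Twisting\<close>

definition is_twist ::
    "('k::field, 'h::ring_1, 'z) quasi_bialg_scheme \<Rightarrow> ('k, 'h) tensor \<Rightarrow> bool" where
  "is_twist H F \<longleftrightarrow> tinvertible H 2 F \<and>
     tmaps H [epst H, idt H] F = tone H 1 \<and> tmaps H [idt H, epst H] F = tone H 1"

definition alpha_by ::
    "('k::field, 'h::ring_1, 'z) quasi_hopf_scheme \<Rightarrow> ('k, 'h) tensor \<Rightarrow> 'h" where
  "alpha_by H Q = teval2 H (\<lambda>x y. antipode H x * alpha H * y) (tinv H 2 Q)"

definition beta_by ::
    "('k::field, 'h::ring_1, 'z) quasi_hopf_scheme \<Rightarrow> ('k, 'h) tensor \<Rightarrow> 'h" where
  "beta_by H Q = teval2 H (\<lambda>x y. x * beta H * antipode H y) Q"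

definition twist ::
    "('k::field, 'h::ring_1, 'z) quasi_hopf_scheme \<Rightarrow> ('k, 'h) tensor
      \<Rightarrow> ('k, 'h, 'z) quasi_hopf_scheme" where
  "twist H F = H\<lparr>
     comul := \<lambda>a. F \<odot>\<^bsub>H\<^esub> \<Delta>\<^bsub>H\<^esub> a \<odot>\<^bsub>H\<^esub> tinv H 2 F,
     assoc := (F \<otimes>\<^bsub>H\<^esub> tone H 1) \<odot>\<^bsub>H\<^esub> tmaps H [\<Delta>\<^bsub>H\<^esub>, idt H] F \<odot>\<^bsub>H\<^esub> \<Phi>\<^bsub>H\<^esub>
       \<odot>\<^bsub>H\<^esub> tmaps H [idt H, \<Delta>\<^bsub>H\<^esub>] (tinv H 2 F) \<odot>\<^bsub>H\<^esub> (tone H 1 \<otimes>\<^bsub>H\<^esub> tinv H 2 F),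
     alpha := alpha_by H F,
     beta := beta_by H F\<rparr>"

definition twist_R ::
    "('k::field, 'h::ring_1, 'z) kalg_scheme \<Rightarrow> ('k, 'h) tensor \<Rightarrow> ('k, 'h) tensor
      \<Rightarrow> ('k, 'h) tensor" where
  "twist_R H F R = flip H F \<odot>\<^bsub>H\<^esub> R \<odot>\<^bsub>H\<^esub> tinv H 2 F"

definition R_tilde ::
    "('k::field, 'h::ring_1, 'z) kalg_scheme \<Rightarrow> ('k, 'h) tensor \<Rightarrow> ('k, 'h) tensor" where
  "R_tilde H R = tinv H 2 (flip H R)"


section \<open>The u-operator\<close>

definition is_u_operator ::
    "('k::field, 'h::ring_1, 'z) quasi_hopf_scheme \<Rightarrow> ('k, 'h) tensor \<Rightarrow> 'h \<Rightarrow> bool" where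
  "is_u_operator H Q u \<longleftrightarrow>
     (\<exists>v. u * v = 1 \<and> v * u = 1 \<and> (\<forall>a. antipode H (antipode H a) = u * a * v)) \<and>
     u * inv (antipode H) (alpha H) = alpha_by H Q \<and>
     beta_by H Q * u = inv (antipode H) (beta H)"

definition u_operator ::
    "('k::field, 'h::ring_1, 'z) quasi_hopf_scheme \<Rightarrow> ('k, 'h) tensor \<Rightarrow> 'h" where
  "u_operator H Q = (THE u. is_u_operator H Q u)"

end

theory Submission
  imports Defs
begin

text \<open>
  The \<open>u\<close>-operator of an \<open>R\<close>-matrix \<open>Q\<close> is characterised by three conditions: \<open>u\<close> implements
  \<open>S\<^sup>2\<close> by conjugation, \<open>u S\<^sup>-\<^sup>1(\<alpha>) = \<alpha>\<^sub>Q\<close> and \<open>\<beta>\<^sub>Q u = S\<^sup>-\<^sup>1(\<beta>)\<close>.  Twisting leaves \<open>S\<close> alone, hence also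
  the first condition; the point is that, given the first condition, each of the other two
  is equivalent to its twisted version, for the same \<open>u\<close>.  So the two structures
  have the same set of \<open>u\<close>-operators.

  Write \<open>m \<cdot> t = \<Sum> S(x) m y\<close> for \<open>t = \<Sum> x \<otimes> y\<close> (this is \<open>alpha_act\<close> below), so that
  \<open>\<alpha>\<^sub>F = \<alpha> \<cdot> F\<^sup>-\<^sup>1\<close>.  Since \<open>S\<close> is an anti-homomorphism, this is a right action of the algebra
  \<open>H \<otimes> H\<close> (\<open>alpha_act_mul\<close>).  With \<open>Q\<^sub>F = F\<^sup>T Q F\<^sup>-\<^sup>1\<close> the factors \<open>F\<close> cancel:
  \<open>(\<alpha>\<^sub>F)\<close> twisted by \<open>Q\<^sub>F\<close> is \<open>\<alpha> \<cdot> F\<^sup>-\<^sup>1 F Q\<^sup>-\<^sup>1 (F\<^sup>T)\<^sup>-\<^sup>1 = \<alpha>\<^sub>Q \<cdot> (F\<^sup>T)\<^sup>-\<^sup>1\<close>.  On the other side,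
  \<open>u S\<^sup>-\<^sup>1(y) = S(y) u\<close> yields \<open>u S\<^sup>-\<^sup>1(m \<cdot> t) = (u S\<^sup>-\<^sup>1(m)) \<cdot> t\<^sup>T\<close> (\<open>alpha_act_flip\<close>), and therefore
  \<open>u S\<^sup>-\<^sup>1(\<alpha>\<^sub>F) = (u S\<^sup>-\<^sup>1(\<alpha>)) \<cdot> (F\<^sup>T)\<^sup>-\<^sup>1\<close>.  Both sides of the condition on \<open>\<alpha>\<close> have been acted on by
  the same invertible element \<open>(F\<^sup>T)\<^sup>-\<^sup>1\<close>, which proves the equivalence.  The condition on \<open>\<beta>\<close> is
  handled in the same way with the left action \<open>m \<mapsto> \<Sum> x m S(y)\<close> (\<open>beta_act\<close>).

  The argument applies to every invertible \<open>Q\<close>, in particular to \<open>\<R>\<close> and to \<open>(\<R>\<^sup>T)\<^sup>-\<^sup>1\<close>; the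
  passage from one to the other commutes with twisting (\<open>R_tilde_twist_R\<close>).
  The remaining work is the associative unital algebra structure of the tensor powers,
  the flip as an involutive homomorphism, and the evaluation of bilinear maps on \<open>H \<otimes> H\<close>.
\<close>


section \<open>Multilinear functions on words\<close>

text \<open>
  The subspace \<open>N\<close> is \<open>{0}\<close> for functions with values in \<open>H\<close>, and \<open>tnull H\<close> for functions that
  produce representatives of tensors, which are multilinear only as cosets.
\<close>

definition multilinear_mod ::
    "('k::field, 'h::ring_1, 'z) kalg_scheme \<Rightarrow> ('k \<Rightarrow> 'b::ab_group_add \<Rightarrow> 'b) \<Rightarrow> 'b set
      \<Rightarrow> ('h list \<Rightarrow> 'b) \<Rightarrow> bool" where
  "multilinear_mod H sc N f \<longleftrightarrow>
     (\<forall>xs a b ys. f (xs @ (a + b) # ys) - f (xs @ a # ys) - f (xs @ b # ys) \<in> N) \<and>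
     (\<forall>xs c a ys. f (xs @ scal H c a # ys) - sc c (f (xs @ a # ys)) \<in> N)"

lemma sum_single_lookup:
  fixes p :: "'a \<Rightarrow>\<^sub>0 'b::comm_monoid_add"
  shows "(\<Sum>x \<in> Poly_Mapping.keys p. Poly_Mapping.single x (Poly_Mapping.lookup p x)) = p"
  by (rule poly_mapping_eqI)
     (auto simp: lookup_sum lookup_single when_def in_keys_iff sum.delta)

text \<open>
  This reduces every identity between (multi)linear maps of formal combinations to words.
\<close>

lemma poly_mapping_single_induct [case_names single add]:
  fixes p :: "'a \<Rightarrow>\<^sub>0 'b::comm_monoid_add"
  assumes single: "\<And>x c. P (Poly_Mapping.single x c)"
    and add: "\<And>p q. P p \<Longrightarrow> P q \<Longrightarrow> P (p + q)"
  shows "P p"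
proof -
  have "P (\<Sum>x \<in> A. Poly_Mapping.single x (Poly_Mapping.lookup p x))" for A
    by (induction A rule: infinite_finite_induct)
       (use single[of undefined 0] in \<open>auto intro: assms\<close>)
  from this[of "Poly_Mapping.keys p"] show ?thesis by (simp add: sum_single_lookup)
qed

lemmas lext_formal = lext_hom[OF fs.vector_space_axioms]

lemma fscale_single [simp]: "fscale c (Poly_Mapping.single xs d) = Poly_Mapping.single xs (c * d)"
  by (rule poly_mapping_eqI) (simp add: lookup_single when_def)

lemma lext_eq_self:
  assumes "\<And>xs. xs \<in> Poly_Mapping.keys p \<Longrightarrow> f xs = Poly_Mapping.single xs 1"
  shows "lext fscale f p = p"
proof -
  have "lext fscale f p = lext fscale (\<lambda>xs. Poly_Mapping.single xs 1) p"
    using assms by (simp add: lext_def)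
  then show ?thesis by (simp add: lext_def sum_single_lookup)
qed

lemma tnull_add: "p \<in> tnull H \<Longrightarrow> q \<in> tnull H \<Longrightarrow> p + q \<in> tnull H"
  unfolding tnull_def by (rule fs.span_add)

lemma tnull_fscale: "p \<in> tnull H \<Longrightarrow> fscale c p \<in> tnull H"
  unfolding tnull_def by (rule fs.span_scale)

lemma tnull_0 [simp]: "0 \<in> tnull H"
  unfolding tnull_def by (rule fs.span_zero)

lemma single_multilinear:
  "multilinear_mod H fscale (tnull H) (\<lambda>xs. Poly_Mapping.single xs 1)"
proof -
  have "p \<in> tnull H" if "p \<in> relators H" for p
    using that unfolding tnull_def by (rule fs.span_base)
  then show ?thesis
    unfolding multilinear_mod_def relators_def fscale_single by fastforce
qed

lemma lext_in_tnull:
  assumes "\<And>xs. f xs \<in> tnull H" shows "lext fscale f p \<in> tnull H"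
  unfolding lext_def tnull_def
  by (intro fs.span_sum fs.span_scale) (use assms in \<open>simp add: tnull_def\<close>)

lemma lext_pointwise:
  "lext fscale (\<lambda>xs. f xs - g xs) p = lext fscale f p - lext fscale g p"
  "lext fscale (\<lambda>xs. fscale c (f xs)) p = fscale c (lext fscale f p)"
  by (simp_all add: lext_def fs.scale_right_diff_distrib sum_subtractf fs.scale_sum_right mult.commute)

lemma lext_multilinear:
  assumes "\<And>ys. multilinear_mod H fscale (tnull H) (\<lambda>xs. f xs ys)"
  shows "multilinear_mod H fscale (tnull H) (\<lambda>xs. lext fscale (f xs) q)"
  unfolding multilinear_mod_def lext_pointwise[symmetric]
  using assms by (auto simp: multilinear_mod_def intro!: lext_in_tnull)

lemma tadd_tclass: "tadd H (tclass H p) (tclass H q) = tclass H (p + q)"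
  using tnull_add[OF trep_tclass[of H p] trep_tclass[of H q]]
  by (simp add: tadd_def tclass_eq_iff algebra_simps)

lemma tscale_tclass: "tscale H c (tclass H p) = tclass H (fscale c p)"
  using tnull_fscale[OF trep_tclass[of H p], of c]
  by (simp add: tscale_def tclass_eq_iff fs.scale_right_diff_distrib)

text \<open>
  The bridge from tensors to formal combinations: a linear map of tensors is computed by
  choosing a representative \<open>f xs\<close> of each value and extending \<open>f\<close> linearly.
\<close>

lemma tlift_tclass_multilinear:
  assumes w: "\<And>xs. w xs = tclass H (f xs)" and f: "multilinear_mod H fscale (tnull H) f"
  shows "tlift H w (tclass H p) = tclass H (lext fscale f p)"
proof -
  have "tlift H w (tclass H p) = tclass H (lext fscale (\<lambda>xs. trep (w xs)) p)"
    unfolding lext_def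
    by (rule tlift_tclass)
       (use f in \<open>auto simp: w multilinear_mod_def tadd_tclass tscale_tclass tclass_eq_iff diff_diff_eq\<close>)
  also have "\<dots> = tclass H (lext fscale f p)"
    unfolding tclass_eq_iff lext_pointwise(1)[symmetric]
    by (rule lext_in_tnull) (simp add: w trep_tclass)
  finally show ?thesis .
qed

lemma (in k_algebra) teval_tclass_multilinear:
  assumes "multilinear_mod H (scal H) {0} g"
  shows "teval H g (tclass H p) = lext (scal H) g p"
  unfolding lext_def
  by (rule teval_tclass)
     (use assms in \<open>auto simp: multilinear_mod_def vector_space_axioms diff_diff_eq\<close>)


section \<open>The product of tensors\<close>

text \<open>
  The product is lifted to representatives, where it is a product of formal combinations that is
  associative on the nose; its descent to tensors is \<open>tmul_tclass\<close>.
\<close>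

definition word_mul :: "'h::ring_1 list \<Rightarrow> 'h list \<Rightarrow> ('k::field, 'h) formal" where
  "word_mul xs ys =
     (if length xs = length ys then Poly_Mapping.single (map2 (*) xs ys) 1 else 0)"

definition formal_mul ::
    "('k::field, 'h::ring_1) formal \<Rightarrow> ('k, 'h) formal \<Rightarrow> ('k, 'h) formal" where
  "formal_mul p q = lext fscale (\<lambda>xs. lext fscale (word_mul xs) q) p"

lemma formal_mul_add_left: "formal_mul (p + p') q = formal_mul p q + formal_mul p' q"
  by (simp add: formal_mul_def lext_formal)

lemma formal_mul_add_right: "formal_mul p (q + q') = formal_mul p q + formal_mul p q'"
  by (induction p rule: poly_mapping_single_induct)
     (simp_all add: formal_mul_def lext_formal fs.scale_right_distrib)

lemma formal_mul_0 [simp]: "formal_mul 0 q = 0" "formal_mul p 0 = 0"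
  by (simp_all add: formal_mul_def lext_formal) (simp add: lext_def)

lemma formal_mul_single:
  "formal_mul (Poly_Mapping.single xs c) (Poly_Mapping.single ys d) =
     (if length xs = length ys then Poly_Mapping.single (map2 (*) xs ys) (c * d) else 0)"
  by (simp add: formal_mul_def lext_formal word_mul_def)

lemma map2_mult_assoc:
  fixes xs ys zs :: "'h::ring_1 list"
  shows "map2 (*) (map2 (*) xs ys) zs = map2 (*) xs (map2 (*) ys zs)"
proof (induction xs arbitrary: ys zs)
  case (Cons x xs)
  then show ?case by (cases ys; cases zs) (simp_all add: mult.assoc)
qed simp

lemma formal_mul_assoc: "formal_mul (formal_mul p q) r = formal_mul p (formal_mul q r)"
proof (induction p rule: poly_mapping_single_induct)
  case (single xs c)
  show ?case
  proof (induction q rule: poly_mapping_single_induct)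
    case (single ys d)
    show ?case
      by (induction r rule: poly_mapping_single_induct)
         (auto simp: formal_mul_single formal_mul_add_right map2_mult_assoc mult.assoc)
  qed (simp add: formal_mul_add_left formal_mul_add_right)
qed (simp add: formal_mul_add_left)

text \<open>Locates the letter of \<open>zs\<close> that a given letter of the other factor is multiplied with.\<close>

lemma length_SucE:
  assumes "length zs = Suc (m + n)"
  obtains us z vs where "zs = us @ z # vs" "length us = m" "length vs = n"
proof
  show "zs = take m zs @ zs ! m # drop (Suc m) zs" by (rule id_take_nth_drop) (simp add: assms)
qed (simp_all add: assms)

definition homogeneous :: "nat \<Rightarrow> ('k::field, 'h) formal \<Rightarrow> bool" where
  "homogeneous n p \<longleftrightarrow> (\<forall>xs \<in> Poly_Mapping.keys p. length xs = n)"

lemma homogeneous_lext: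
  assumes "\<And>xs. xs \<in> Poly_Mapping.keys p \<Longrightarrow> homogeneous n (f xs)"
  shows "homogeneous n (lext fscale f p)"
  unfolding homogeneous_def
proof
  fix ys assume "ys \<in> Poly_Mapping.keys (lext fscale f p)"
  then obtain xs where xs: "xs \<in> Poly_Mapping.keys p"
      "ys \<in> Poly_Mapping.keys (fscale (Poly_Mapping.lookup p xs) (f xs))"
    using keys_sum[of "\<lambda>xs. fscale (Poly_Mapping.lookup p xs) (f xs)" "Poly_Mapping.keys p"]
    by (auto simp only: lext_def)
  then have "ys \<in> Poly_Mapping.keys (f xs)" by (simp add: in_keys_iff)
  with xs(1) assms show "length ys = n" by (auto simp: homogeneous_def)
qed

lemma homogeneous_mul:
  assumes "homogeneous n p" "homogeneous n q" shows "homogeneous n (formal_mul p q)"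
  unfolding formal_mul_def
  by (intro homogeneous_lext) (use assms in \<open>auto simp: homogeneous_def word_mul_def\<close>)

lemma map2_mult_one:
  fixes xs :: "'h::ring_1 list"
  shows "map2 (*) xs (replicate (length xs) 1) = xs" "map2 (*) (replicate (length xs) 1) xs = xs"
  by (induction xs) auto

lemma formal_mul_one:
  assumes "homogeneous n p"
  shows "formal_mul p (Poly_Mapping.single (replicate n 1) 1) = p"
    and "formal_mul (Poly_Mapping.single (replicate n 1) 1) p = p"
proof -
  have w: "word_mul xs (replicate n 1) = Poly_Mapping.single xs 1"
    "word_mul (replicate n 1) xs = Poly_Mapping.single xs 1"
    if "xs \<in> Poly_Mapping.keys p" for xs
  proof -
    have "n = length xs" using assms that by (simp add: homogeneous_def)
    then show "word_mul xs (replicate n 1) = Poly_Mapping.single xs 1"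
      "word_mul (replicate n 1) xs = Poly_Mapping.single xs 1"
      by (simp_all only: word_mul_def map2_mult_one length_replicate simp_thms if_True)
  qed
  show "formal_mul p (Poly_Mapping.single (replicate n 1) 1) = p"
    unfolding formal_mul_def by (rule lext_eq_self) (simp add: lext_formal(4) w)
  show "formal_mul (Poly_Mapping.single (replicate n 1) 1) p = p"
    unfolding formal_mul_def lext_formal(4) fs.scale_one by (rule lext_eq_self) (rule w)
qed

lemma tpow_homogeneous: "tpow H n = tclass H ` {p. homogeneous n p}"
  by (simp add: tpow_def homogeneous_def)

context k_algebra
begin

lemma word_mul_multilinear:
  shows "multilinear_mod H fscale (tnull H) (\<lambda>xs. word_mul xs zs)"
    and "multilinear_mod H fscale (tnull H) (word_mul zs)"
proof -
  note s = single_multilinear[of H, unfolded multilinear_mod_def]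
  show "multilinear_mod H fscale (tnull H) (\<lambda>xs. word_mul xs zs)"
    unfolding multilinear_mod_def
  proof (intro conjI allI, goal_cases)
    case (1 xs a b ys)
    show ?case
    proof (cases "length zs = Suc (length xs + length ys)")
      case True
      then show ?thesis by (rule length_SucE) (use s in \<open>simp add: word_mul_def distrib_right\<close>)
    qed (simp add: word_mul_def)
  next
    case (2 xs c a ys)
    show ?case
    proof (cases "length zs = Suc (length xs + length ys)")
      case True
      then show ?thesis
        by (rule length_SucE) (use s in \<open>simp add: word_mul_def scal_mult_left[symmetric]\<close>)
    qed (simp add: word_mul_def)
  qed
  show "multilinear_mod H fscale (tnull H) (word_mul zs)"
    unfolding multilinear_mod_def
  proof (intro conjI allI, goal_cases)
    case (1 xs a b ys)
    show ?case
    proof (cases "length zs = Suc (length xs + length ys)")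
      case True
      then show ?thesis by (rule length_SucE) (use s in \<open>simp add: word_mul_def distrib_left\<close>)
    qed (simp add: word_mul_def)
  next
    case (2 xs c a ys)
    show ?case
    proof (cases "length zs = Suc (length xs + length ys)")
      case True
      then show ?thesis
        by (rule length_SucE) (use s in \<open>simp add: word_mul_def scal_mult_right[symmetric]\<close>)
    qed (simp add: word_mul_def)
  qed
qed

lemma tmul_tclass: "tclass H p \<odot> tclass H q = tclass H (formal_mul p q)"
  unfolding tmul_def formal_mul_def
proof (rule tlift_tclass_multilinear)
  show "tlift H (\<lambda>ys. if length xs = length ys then pure H (map2 (*) xs ys) else tzero H)
      (tclass H q) = tclass H (lext fscale (word_mul xs) q)" for xs
    by (rule tlift_tclass_multilinear[OF _ word_mul_multilinear(2)])
       (simp add: pure_def tzero_def word_mul_def)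
  show "multilinear_mod H fscale (tnull H) (\<lambda>xs. lext fscale (word_mul xs) q)"
    by (rule lext_multilinear) (rule word_mul_multilinear(1))
qed

lemma tmul_closed: "s \<in> tpow H n \<Longrightarrow> t \<in> tpow H n \<Longrightarrow> s \<odot> t \<in> tpow H n"
  by (auto simp: tpow_homogeneous tmul_tclass intro: homogeneous_mul)

lemma tmul_assoc:
  assumes "r \<in> tpow H l" "s \<in> tpow H m" "t \<in> tpow H n"
  shows "r \<odot> s \<odot> t = r \<odot> (s \<odot> t)"
  using assms by (auto simp: tpow_homogeneous tmul_tclass formal_mul_assoc)

lemma tmul_tone:
  assumes "t \<in> tpow H n" shows "t \<odot> tone H n = t" "tone H n \<odot> t = t"
  using assms by (auto simp: tpow_homogeneous tone_def pure_def tmul_tclass formal_mul_one)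

text \<open>
  Inverse pairs as a relation, so that inverses of products, flips and inverses can be exhibited
  before \<open>tinv\<close>, which is a definite description, is evaluated.
\<close>

definition tinverses :: "nat \<Rightarrow> ('k, 'h) tensor \<Rightarrow> ('k, 'h) tensor \<Rightarrow> bool" where
  "tinverses n s t \<longleftrightarrow> s \<in> tpow H n \<and> is_tinverse H n s t"

lemma tinvertible_iff: "tinvertible H n s \<longleftrightarrow> (\<exists>t. tinverses n s t)"
  by (auto simp: tinvertible_def tinverses_def)

lemma tinverses_sym: "tinverses n s t \<Longrightarrow> tinverses n t s"
  by (simp add: tinverses_def is_tinverse_def)

lemma tinverses_unique:
  assumes "tinverses n s t" "tinverses n s t'" shows "t' = t"
proof -
  have m: "s \<in> tpow H n" "t \<in> tpow H n" "t' \<in> tpow H n" "t' \<odot> s = tone H n" "s \<odot> t = tone H n"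
    using assms by (simp_all add: tinverses_def is_tinverse_def)
  have "t' = t' \<odot> (s \<odot> t)" by (simp only: m tmul_tone)
  also have "\<dots> = t' \<odot> s \<odot> t" by (rule tmul_assoc[symmetric, OF m(3,1,2)])
  also have "\<dots> = t" by (simp only: m tmul_tone)
  finally show ?thesis .
qed

lemma tinverses_tinv: "tinverses n s t \<Longrightarrow> tinv H n s = t"
  unfolding tinv_def
  by (rule the_equality) (simp_all add: tinverses_def tinverses_unique)

lemma tinverses_mul:
  assumes "tinverses n s s'" "tinverses n t t'" shows "tinverses n (s \<odot> t) (t' \<odot> s')"
proof -
  have cancel: "s \<odot> t \<odot> (t' \<odot> s') = tone H n" if "tinverses n s s'" "tinverses n t t'" for s t s' t'
  proof -
    have t: "t \<odot> (t' \<odot> s') = s'"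
      using that by (simp add: tinverses_def is_tinverse_def tmul_tone flip: tmul_assoc[of _ n _ n _ n])
    have "s \<odot> t \<odot> (t' \<odot> s') = s \<odot> (t \<odot> (t' \<odot> s'))"
      using that by (simp add: tinverses_def is_tinverse_def tmul_assoc[of _ n _ n _ n] tmul_closed)
    then show ?thesis using that by (simp add: t) (simp add: tinverses_def is_tinverse_def)
  qed
  show ?thesis
    using cancel[OF assms] cancel[OF assms(2,1)[THEN tinverses_sym]] assms
    by (simp add: tinverses_def is_tinverse_def tmul_closed)
qed

end


section \<open>Evaluation and flip of two-fold tensors\<close>

lemma multilinear_mod_pair:
  assumes "\<And>a b y. g (a + b) y - g a y - g b y \<in> N" "\<And>a b x. g x (a + b) - g x a - g x b \<in> N"
    and "\<And>c a y. g (scal H c a) y - sc c (g a y) \<in> N" "\<And>c a x. g x (scal H c a) - sc c (g x a) \<in> N"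
    and "0 \<in> N" "\<And>c. sc c 0 = 0"
  shows "multilinear_mod H sc N (\<lambda>xs. case xs of [x, y] \<Rightarrow> g x y | _ \<Rightarrow> 0)"
  unfolding multilinear_mod_def
proof (intro conjI allI, goal_cases)
  case (1 xs a b ys)
  show ?case using assms
    by (cases xs; cases "tl xs"; cases ys; cases "tl ys") (simp_all split: list.splits)
next
  case (2 xs c a ys)
  show ?case using assms
    by (cases xs; cases "tl xs"; cases ys; cases "tl ys") (simp_all split: list.splits)
qed

definition bilinear_map ::
    "('k::field, 'h::ring_1, 'z) kalg_scheme \<Rightarrow> ('h \<Rightarrow> 'h \<Rightarrow> 'h) \<Rightarrow> bool" where
  "bilinear_map H g \<longleftrightarrow>
     (\<forall>x y z. g (x + y) z = g x z + g y z) \<and> (\<forall>x y z. g x (y + z) = g x y + g x z) \<and>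
     (\<forall>c x y. g (scal H c x) y = scal H c (g x y)) \<and>
     (\<forall>c x y. g x (scal H c y) = scal H c (g x y))"

definition formal_flip :: "('k::field, 'h) formal \<Rightarrow> ('k, 'h) formal" where
  "formal_flip = lext fscale (\<lambda>xs. case xs of [x, y] \<Rightarrow> Poly_Mapping.single [y, x] 1 | _ \<Rightarrow> 0)"

lemma formal_flip_add: "formal_flip (p + q) = formal_flip p + formal_flip q"
  by (simp add: formal_flip_def lext_formal)

lemma formal_flip_0 [simp]: "formal_flip 0 = 0"
  by (simp add: formal_flip_def lext_formal)

lemma formal_flip_single:
  "formal_flip (Poly_Mapping.single xs c) =
     (if length xs = 2 then Poly_Mapping.single (rev xs) c else 0)"
  by (auto simp: formal_flip_def lext_formal numeral_2_eq_2 split: list.splits)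

lemma formal_flip_mul: "formal_flip (formal_mul p q) = formal_mul (formal_flip p) (formal_flip q)"
proof (induction p rule: poly_mapping_single_induct)
  case (single xs c)
  show ?case
  proof (induction q rule: poly_mapping_single_induct)
    case (single ys d)
    show ?case
      by (simp add: formal_mul_single formal_flip_single rev_map zip_rev)
  qed (simp add: formal_mul_add_right formal_flip_add)
qed (simp add: formal_mul_add_left formal_flip_add)

lemma homogeneous_flip: "homogeneous 2 (formal_flip p)"
  unfolding formal_flip_def by (rule homogeneous_lext) (simp add: homogeneous_def split: list.splits)

lemma formal_flip_flip:
  fixes p :: "('k::field, 'h) formal"
  assumes "homogeneous 2 p" shows "formal_flip (formal_flip p) = p"
proof -
  \<comment> \<open>Stated for all \<open>q\<close>, because a splitting \<open>p = q + r\<close> need not have homogeneous summands.\<close>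
  have *: "formal_flip (formal_flip q) =
      lext fscale (\<lambda>xs. formal_flip (formal_flip (Poly_Mapping.single xs 1))) q" for q :: "('k, 'h) formal"
    by (induction q rule: poly_mapping_single_induct)
       (simp_all add: formal_flip_add formal_flip_single lext_formal)
  show ?thesis
    by (subst *, rule lext_eq_self)
       (use assms in \<open>auto simp: homogeneous_def formal_flip_single\<close>)
qed

context k_algebra
begin

lemma flip_tclass: "flip H (tclass H p) = tclass H (formal_flip p)"
  unfolding flip_def legs2_def formal_flip_def
proof (rule tlift_tclass_multilinear)
  show "(case xs of [x, y] \<Rightarrow> pure H [y, x] | _ \<Rightarrow> tzero H) =
      tclass H (case xs of [x, y] \<Rightarrow> Poly_Mapping.single [y, x] 1 | _ \<Rightarrow> 0)" for xs
    by (simp add: pure_def tzero_def split: list.splits)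
  note s = single_multilinear[of H, unfolded multilinear_mod_def]
  show "multilinear_mod H fscale (tnull H)
      (\<lambda>xs. case xs of [x, y] \<Rightarrow> Poly_Mapping.single [y, x] 1 | _ \<Rightarrow> 0)"
    by (rule multilinear_mod_pair)
       (use s[THEN conjunct1, rule_format, of "[]" _ _ "[_]"]
            s[THEN conjunct1, rule_format, of "[_]" _ _ "[]"]
            s[THEN conjunct2, rule_format, of "[]" _ _ "[_]"]
            s[THEN conjunct2, rule_format, of "[_]" _ _ "[]"] in simp_all)
qed

lemma flip_closed: "t \<in> tpow H 2 \<Longrightarrow> flip H t \<in> tpow H 2"
  by (auto simp: tpow_homogeneous flip_tclass intro: homogeneous_flip)

lemma flip_flip: "t \<in> tpow H 2 \<Longrightarrow> flip H (flip H t) = t"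
  by (auto simp: tpow_homogeneous flip_tclass formal_flip_flip)

lemma flip_tmul: "s \<in> tpow H m \<Longrightarrow> t \<in> tpow H n \<Longrightarrow> flip H (s \<odot> t) = flip H s \<odot> flip H t"
  by (auto simp: tpow_homogeneous flip_tclass tmul_tclass formal_flip_mul)

lemma flip_tone: "flip H (tone H 2) = tone H 2"
  by (simp add: tone_def pure_def flip_tclass formal_flip_single numeral_2_eq_2)

lemma tinverses_flip: "tinverses 2 s t \<Longrightarrow> tinverses 2 (flip H s) (flip H t)"
  by (simp add: tinverses_def is_tinverse_def flip_closed flip_tone flip: flip_tmul[of _ 2 _ 2])

lemma teval2_tclass:
  assumes "bilinear_map H g"
  shows "teval2 H g (tclass H p) = lext (scal H) (\<lambda>xs. case xs of [x, y] \<Rightarrow> g x y | _ \<Rightarrow> 0) p"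
  unfolding teval2_def
  by (rule teval_tclass_multilinear, rule multilinear_mod_pair)
     (use assms in \<open>simp_all add: bilinear_map_def\<close>)

lemma teval2_single:
  assumes "bilinear_map H g"
  shows "teval2 H g (tclass H (Poly_Mapping.single xs c)) =
    (if length xs = 2 then scal H c (g (xs ! 0) (xs ! 1)) else 0)"
  by (auto simp: teval2_tclass assms lext_hom[OF vector_space_axioms] numeral_2_eq_2
    split: list.splits)

lemma teval2_add:
  assumes "bilinear_map H g"
  shows "teval2 H g (tclass H (p + q)) = teval2 H g (tclass H p) + teval2 H g (tclass H q)"
  by (simp add: teval2_tclass assms lext_hom[OF vector_space_axioms])

lemma teval2_0: "bilinear_map H g \<Longrightarrow> teval2 H g (tclass H 0) = 0"
  using teval2_add[of g 0 0] by simp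

lemma teval2_fun:
  shows teval2_fun_add: "teval2 H (\<lambda>x y. f x y + g x y) t = teval2 H f t + teval2 H g t"
    and teval2_fun_scal: "teval2 H (\<lambda>x y. scal H c (f x y)) t = scal H c (teval2 H f t)"
  unfolding teval2_def teval_def sum.distrib[symmetric] scale_sum_right
  by (auto intro!: sum.cong simp: scale_right_distrib mult.commute split: list.splits)

lemma teval2_flip:
  assumes "bilinear_map H g" "t \<in> tpow H 2"
  shows "teval2 H g (flip H t) = teval2 H (\<lambda>x y. g y x) t"
proof -
  have g: "bilinear_map H (\<lambda>x y. g y x)" using assms(1) by (simp add: bilinear_map_def)
  obtain p where "t = tclass H p" using assms(2) by (auto simp: tpow_homogeneous)
  moreover have "teval2 H g (flip H (tclass H p)) = teval2 H (\<lambda>x y. g y x) (tclass H p)"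
    by (induction p rule: poly_mapping_single_induct)
       (simp_all add: flip_tclass formal_flip_add formal_flip_single teval2_add[OF assms(1)]
         teval2_single[OF assms(1)] teval2_add[OF g] teval2_single[OF g] teval2_0 assms(1) rev_nth)
  ultimately show ?thesis by simp
qed

text \<open>Linear maps pass through the sum over the legs of a tensor.\<close>

lemma teval2_compose:
  assumes "bilinear_map H g" "bilinear_map H h"
    and "\<And>a b. L (a + b) = L a + L b" "\<And>c a. L (scal H c a) = scal H c (L a)"
    and "\<And>x y. L (g x y) = h x y" and "t \<in> tpow H 2"
  shows "L (teval2 H g t) = teval2 H h t"
proof -
  have L0: "L 0 = 0" using assms(4)[of 0] by simp
  obtain p where "t = tclass H p" using assms(6) by (auto simp: tpow_homogeneous)
  moreover have "L (teval2 H g (tclass H p)) = teval2 H h (tclass H p)"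
    by (induction p rule: poly_mapping_single_induct)
       (simp_all add: assms(1-5) L0 teval2_add teval2_single)
  ultimately show ?thesis by simp
qed

text \<open>
  Fubini for the factorwise product: the double sum is evaluated with the legs of \<open>t\<close> inside
  and those of \<open>s\<close> outside.
\<close>

lemma teval2_tmul:
  assumes g: "bilinear_map H g" and "s \<in> tpow H 2" "t \<in> tpow H 2"
  shows "teval2 H g (s \<odot> t) = teval2 H (\<lambda>x y. teval2 H (\<lambda>x' y'. g (x * x') (y * y')) t) s"
proof -
  obtain p q where pq: "s = tclass H p" "t = tclass H q"
    using assms by (auto simp: tpow_homogeneous)
  let ?h = "\<lambda>x y. teval2 H (\<lambda>x' y'. g (x * x') (y * y'))"
  have inner: "bilinear_map H (\<lambda>x' y'. g (x * x') (y * y'))" for x y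
    using g by (simp add: bilinear_map_def distrib_left scal_mult_right[symmetric])
  have outer: "bilinear_map H (\<lambda>x y. ?h x y t)" for t
    using g by (simp add: bilinear_map_def distrib_right scal_mult_left[symmetric]
      teval2_fun_add teval2_fun_scal)
  have "teval2 H g (tclass H (formal_mul p q)) = teval2 H (\<lambda>x y. ?h x y (tclass H q)) (tclass H p)"
  proof (induction p rule: poly_mapping_single_induct)
    case (single xs c)
    show ?case unfolding teval2_single[OF outer]
      by (induction q rule: poly_mapping_single_induct)
         (auto simp: formal_mul_single formal_mul_add_right teval2_add[OF g] teval2_add[OF inner]
           teval2_single[OF g] teval2_single[OF inner] teval2_0[OF g] scale_right_distrib)
  qed (simp add: formal_mul_add_left teval2_add[OF g] teval2_add[OF outer])
  then show ?thesis by (simp add: pq tmul_tclass)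
qed

end


section \<open>The two actions of two-fold tensors on a quasi-Hopf algebra\<close>

context quasi_hopf_algebra
begin

definition alpha_act :: "'h \<Rightarrow> ('k, 'h) tensor \<Rightarrow> 'h" where
  "alpha_act m = teval2 H (\<lambda>x y. \<S> x * m * y)"

definition beta_act :: "'h \<Rightarrow> ('k, 'h) tensor \<Rightarrow> 'h" where
  "beta_act m = teval2 H (\<lambda>x y. x * m * \<S> y)"

lemma antipode_add: "\<S> (a + b) = \<S> a + \<S> b"
  and antipode_scal: "\<S> (scal H c a) = scal H c (\<S> a)"
proof -
  interpret S: Vector_Spaces.linear "scal H" "scal H" \<S> by (rule antipode_linear)
  show "\<S> (a + b) = \<S> a + \<S> b" "\<S> (scal H c a) = scal H c (\<S> a)" by (rule S.add S.scale)+
qed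

lemma antipode_inv [simp]: "\<S> (inv \<S> a) = a" "inv \<S> (\<S> a) = a"
  using antipode_bij by (simp_all add: bij_is_surj surj_f_inv_f bij_is_inj)

lemma antipode_eq_iff: "\<S> a = \<S> b \<longleftrightarrow> a = b"
  using antipode_bij by (metis antipode_inv(2))

lemma inv_antipode:
  "inv \<S> (a + b) = inv \<S> a + inv \<S> b"
  "inv \<S> (scal H c a) = scal H c (inv \<S> a)"
  "inv \<S> (a * b) = inv \<S> b * inv \<S> a"
  by (subst antipode_eq_iff[symmetric], simp add: antipode_add antipode_scal antipode_mult)+

lemma scal_mult:
  "scal H c a * b = scal H c (a * b)" "a * scal H c b = scal H c (a * b)"
  by (simp_all add: scal_mult_left scal_mult_right[symmetric])

lemmas bilinear_simps = bilinear_map_def antipode_add antipode_scal inv_antipode distrib_left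
  distrib_right scal_mult mult.assoc

lemma alpha_act_linear:
  "alpha_act (m + n) t = alpha_act m t + alpha_act n t"
  "alpha_act (scal H c m) t = scal H c (alpha_act m t)"
  unfolding alpha_act_def teval2_fun_add[symmetric] teval2_fun_scal[symmetric]
  by (intro arg_cong[where f = "\<lambda>g. teval2 H g t"] ext, simp add: bilinear_simps)+

text \<open>
  A right action because \<open>S(x x') = S(x') S(x)\<close>: the outer factor \<open>s\<close> reaches \<open>m\<close> first.
\<close>

lemma alpha_act_mul:
  assumes "s \<in> tpow H 2" "t \<in> tpow H 2"
  shows "alpha_act m (s \<odot> t) = alpha_act (alpha_act m s) t"
proof -
  have inner: "alpha_act (\<S> x * m * y) t = teval2 H (\<lambda>x' y'. \<S> (x * x') * m * (y * y')) t"
    for x y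
    unfolding alpha_act_def
    by (intro arg_cong[where f = "\<lambda>g. teval2 H g t"] ext) (simp add: antipode_mult mult.assoc)
  have "alpha_act m (s \<odot> t) = teval2 H (\<lambda>x y. alpha_act (\<S> x * m * y) t) s"
    unfolding inner unfolding alpha_act_def
    by (rule teval2_tmul) (simp_all add: assms bilinear_simps)
  also have "\<dots> = alpha_act (alpha_act m s) t"
    unfolding alpha_act_def[of m]
    by (rule teval2_compose[where L = "\<lambda>m. alpha_act m t", symmetric])
       (simp_all add: assms bilinear_simps alpha_act_linear)
  finally show ?thesis .
qed

text \<open>
  A left action: in \<open>x x' m S(y') S(y)\<close> it is the inner factor \<open>t\<close> that reaches \<open>m\<close> first.
\<close>

lemma beta_act_mul:
  assumes "s \<in> tpow H 2" "t \<in> tpow H 2"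
  shows "beta_act m (s \<odot> t) = beta_act (beta_act m t) s"
proof -
  have inner: "x * beta_act m t * \<S> y = teval2 H (\<lambda>x' y'. x * x' * m * \<S> (y * y')) t" for x y
    unfolding beta_act_def
    by (rule teval2_compose[where L = "\<lambda>a. x * a * \<S> y"])
       (simp_all add: assms bilinear_simps antipode_mult)
  have "beta_act m (s \<odot> t) = teval2 H (\<lambda>x y. x * beta_act m t * \<S> y) s"
    unfolding inner unfolding beta_act_def
    by (rule teval2_tmul) (simp_all add: assms bilinear_simps)
  then show ?thesis by (simp add: beta_act_def)
qed

lemma alpha_act_one: "alpha_act m (tone H 2) = m"
  and beta_act_one: "beta_act m (tone H 2) = m"
proof -
  have b: "bilinear_map H (\<lambda>x y. \<S> x * m * y)" "bilinear_map H (\<lambda>x y. x * m * \<S> y)"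
    by (simp_all add: bilinear_simps)
  show "alpha_act m (tone H 2) = m" "beta_act m (tone H 2) = m"
    by (simp_all add: alpha_act_def beta_act_def tone_def pure_def teval2_tclass[OF b(1)]
      teval2_tclass[OF b(2)] lext_hom[OF vector_space_axioms] numeral_2_eq_2 antipode_one)
qed

lemma alpha_act_inj:
  assumes "tinverses 2 s t" shows "alpha_act m s = alpha_act n s \<longleftrightarrow> m = n"
  using assms alpha_act_mul[of s t] alpha_act_one
  unfolding tinverses_def is_tinverse_def by metis

lemma beta_act_inj:
  assumes "tinverses 2 s t" shows "beta_act m s = beta_act n s \<longleftrightarrow> m = n"
  using assms beta_act_mul[of t s] beta_act_one
  unfolding tinverses_def is_tinverse_def by metis

text \<open>
  The hypothesis on \<open>u\<close> is \<open>S\<^sup>2(a) = u a u\<^sup>-\<^sup>1\<close> at \<open>a = S\<^sup>-\<^sup>1(b)\<close>.  Applying \<open>S\<^sup>-\<^sup>1\<close> to \<open>S(x) m y\<close> reverses it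
  to \<open>S\<^sup>-\<^sup>1(y) S\<^sup>-\<^sup>1(m) x\<close>, and moving \<open>u\<close> past the first factor restores \<open>S(y)\<close> on the left;
  only the two legs have been exchanged.
\<close>

lemma alpha_act_flip:
  assumes "\<And>b. u * inv \<S> b = \<S> b * u" and "t \<in> tpow H 2"
  shows "u * inv \<S> (alpha_act m t) = alpha_act (u * inv \<S> m) (flip H t)"
proof -
  have "u * inv \<S> (alpha_act m t) = teval2 H (\<lambda>x y. \<S> y * (u * inv \<S> m) * x) t"
    unfolding alpha_act_def
  proof (rule teval2_compose[where L = "\<lambda>a. u * inv \<S> a"])
    have "u * inv \<S> (\<S> x * m * y) = (u * inv \<S> y) * inv \<S> m * x" for x y
      by (simp add: inv_antipode mult.assoc)
    then show "u * inv \<S> (\<S> x * m * y) = \<S> y * (u * inv \<S> m) * x" for x y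
      by (simp add: assms(1) mult.assoc)
  qed (simp_all add: bilinear_simps assms(2))
  also have "\<dots> = alpha_act (u * inv \<S> m) (flip H t)"
    unfolding alpha_act_def
    by (subst teval2_flip) (simp_all add: bilinear_simps assms(2))
  finally show ?thesis .
qed

text \<open>
  The same computation for \<open>\<Sum> y m S(x) u\<close>.  Stating the right-hand side with \<open>S(m u)\<close> in place
  of a general element makes both sides of the condition on \<open>\<beta>\<close> values of
  \<open>S\<^sup>-\<^sup>1 \<circ> beta_act _ t\<close>, which is injective for invertible \<open>t\<close>.
\<close>

lemma beta_act_flip:
  assumes "\<And>b. u * inv \<S> b = \<S> b * u" and "t \<in> tpow H 2"
  shows "beta_act m (flip H t) * u = inv \<S> (beta_act (\<S> (m * u)) t)"
proof -
  have "beta_act m (flip H t) * u = teval2 H (\<lambda>x y. y * m * \<S> x) t * u"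
    unfolding beta_act_def
    by (subst teval2_flip) (simp_all add: bilinear_simps assms(2))
  also have "\<dots> = teval2 H (\<lambda>x y. y * (m * u) * inv \<S> x) t"
    by (rule teval2_compose[where L = "\<lambda>a. a * u"])
       (simp_all add: bilinear_simps assms)
  also have "\<dots> = inv \<S> (beta_act (\<S> (m * u)) t)"
    unfolding beta_act_def
    by (rule teval2_compose[where L = "inv \<S>", symmetric])
       (simp_all add: bilinear_simps assms(2))
  finally show ?thesis .
qed


section \<open>Twisting\<close>

lemma tinverses_twist_R:
  assumes "tinverses 2 F F'" "tinverses 2 Q Q'"
  shows "tinverses 2 (twist_R H F Q) (F \<odot> Q' \<odot> flip H F')"
proof -
  have "tinverses 2 (flip H F \<odot> Q \<odot> F') (F \<odot> (Q' \<odot> flip H F'))"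
    by (intro tinverses_mul tinverses_flip assms tinverses_sym[OF assms(1)])
  moreover have "F \<odot> (Q' \<odot> flip H F') = F \<odot> Q' \<odot> flip H F'"
    using assms by (simp add: tinverses_def is_tinverse_def tmul_assoc[of _ 2 _ 2 _ 2] flip_closed)
  ultimately show ?thesis by (simp add: twist_R_def tinverses_tinv[OF assms(1)])
qed

text \<open>
  Flipping turns \<open>F\<^sup>T Q F\<^sup>-\<^sup>1\<close> into \<open>F Q\<^sup>T (F\<^sup>T)\<^sup>-\<^sup>1\<close>, and inversion brings \<open>F\<^sup>T\<close> back to the left.
\<close>

lemma R_tilde_twist_R:
  assumes "tinverses 2 F F'" "tinverses 2 Q Q'"
  shows "R_tilde H (twist_R H F Q) = twist_R H F (R_tilde H Q)"
proof -
  have "R_tilde H (twist_R H F Q) = flip H (F \<odot> Q' \<odot> flip H F')"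
    unfolding R_tilde_def by (intro tinverses_tinv tinverses_flip tinverses_twist_R assms)
  also have "\<dots> = flip H F \<odot> flip H Q' \<odot> F'"
    using assms by (simp add: tinverses_def is_tinverse_def flip_tmul[of _ 2 _ 2] tmul_closed
      flip_closed flip_flip)
  also have "\<dots> = twist_R H F (R_tilde H Q)"
    using assms tinverses_flip[OF assms(2)] by (simp add: twist_R_def R_tilde_def tinverses_tinv)
  finally show ?thesis .
qed

lemma alpha_by_eq: "tinverses 2 Q Q' \<Longrightarrow> alpha_by H Q = alpha_act \<alpha> Q'"
  by (simp add: alpha_by_def alpha_act_def tinverses_tinv)

lemma beta_by_eq: "beta_by H Q = beta_act \<beta> Q"
  by (simp add: beta_by_def beta_act_def)

end

lemma twist_simps:
  "scal (twist H F) = scal H" "antipode (twist H F) = antipode H"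
  "alpha (twist H F) = alpha_by H F" "beta (twist H F) = beta_by H F"
  by (simp_all add: twist_def)

text \<open>
  The tensor powers and their products depend on the structure only through the
  scalar multiplication, which a twist does not touch.
\<close>

lemma tensor_ops_twist:
  "tclass (twist H F) = tclass H"
  "tlift (twist H F) = tlift H"
  "pure (twist H F) = pure H"
  "tmul (twist H F) = tmul H"
  "tpow (twist H F) = tpow H"
  "tinv (twist H F) = tinv H"
  "teval2 (twist H F) = teval2 H"
  "R_tilde (twist H F) = R_tilde H"
proof -
  show c: "tclass (twist H F) = tclass H"
    by (intro ext) (simp add: tclass_def tnull_def relators_def twist_simps)
  then show l: "tlift (twist H F) = tlift H" and p: "pure (twist H F) = pure H"
    by (intro ext, simp add: tlift_def pure_def)+
  show m: "tmul (twist H F) = tmul H"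
    by (intro ext) (simp only: tmul_def l p c tzero_def)
  show t: "tpow (twist H F) = tpow H" by (intro ext) (simp add: tpow_def c)
  show i: "tinv (twist H F) = tinv H"
    by (intro ext) (simp add: tinv_def is_tinverse_def tone_def p m t)
  show "teval2 (twist H F) = teval2 H"
    by (intro ext) (simp add: teval2_def teval_def twist_simps)
  show "R_tilde (twist H F) = R_tilde H"
    by (intro ext) (simp only: R_tilde_def i flip_def legs2_def l p c tzero_def)
qed

context quasi_hopf_algebra
begin

text \<open>
  If \<open>u\<close> implements \<open>S\<^sup>2\<close>, both sides of its \<open>\<alpha>\<close>-condition for the twisted structure are the images of
  the untwisted sides under the injective action of \<open>(F\<^sup>T)\<^sup>-\<^sup>1\<close>, and similarly for \<open>\<beta>\<close>.
\<close>

lemma is_u_operator_twist_iff: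
  assumes F: "tinverses 2 F F'" and Q: "tinverses 2 Q Q'"
  shows "is_u_operator (twist H F) (twist_R H F Q) u \<longleftrightarrow> is_u_operator H Q u"
proof (cases "\<exists>v. u * v = 1 \<and> v * u = 1 \<and> (\<forall>a. \<S> (\<S> a) = u * a * v)")
  case True
  then obtain v where v: "v * u = 1" "\<And>a. \<S> (\<S> a) = u * a * v" by blast
  have u: "u * inv \<S> b = \<S> b * u" for b
    using v(2)[of "inv \<S> b"] by (simp add: mult.assoc v(1))
  note T = tensor_ops_twist twist_simps
  have closed: "F \<in> tpow H 2" "F' \<in> tpow H 2" "Q \<in> tpow H 2" "Q' \<in> tpow H 2"
    and FF: "F' \<odot> F = tone H 2"
    using F Q by (simp_all add: tinverses_def is_tinverse_def)
  note closed = closed closed[THEN flip_closed] tmul_closed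
  note assoc = tmul_assoc[of _ 2 _ 2 _ 2]
  \<comment> \<open>In both chains the twist inside \<open>\<alpha>\<^sub>F\<close> or \<open>\<beta>\<^sub>F\<close> cancels against the factor of \<open>Q\<^sub>F\<close> next to it.\<close>
  have "alpha_by (twist H F) (twist_R H F Q) =
      alpha_act (alpha_act \<alpha> F') (F \<odot> Q' \<odot> flip H F')"
    by (simp add: alpha_by_def T tinverses_tinv[OF tinverses_twist_R[OF F Q]] alpha_act_def
      tinverses_tinv[OF F])
  also have "\<dots> = alpha_act \<alpha> (F' \<odot> F \<odot> Q' \<odot> flip H F')"
    by (simp add: alpha_act_mul[symmetric] closed assoc)
  also have "\<dots> = alpha_act (alpha_act \<alpha> Q') (flip H F')"
    by (simp add: FF tmul_tone closed alpha_act_mul)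
  finally have a: "alpha_by (twist H F) (twist_R H F Q) =
    alpha_act (alpha_act \<alpha> Q') (flip H F')" .
  have "beta_by (twist H F) (twist_R H F Q) = beta_act (beta_act \<beta> F) (flip H F \<odot> Q \<odot> F')"
    by (simp add: beta_by_def T twist_R_def tinverses_tinv[OF F] beta_act_def)
  also have "\<dots> = beta_act \<beta> (flip H F \<odot> Q \<odot> (F' \<odot> F))"
    by (simp add: beta_act_mul[symmetric] closed assoc)
  also have "\<dots> = beta_act (beta_act \<beta> Q) (flip H F)"
    by (simp add: FF tmul_tone closed beta_act_mul)
  finally have b: "beta_by (twist H F) (twist_R H F Q) =
    beta_act (beta_act \<beta> Q) (flip H F)" .
  have "u * inv \<S> (alpha_act \<alpha> F') = alpha_act (alpha_act \<alpha> Q') (flip H F') \<longleftrightarrow>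
      u * inv \<S> \<alpha> = alpha_act \<alpha> Q'"
    by (simp add: alpha_act_flip[OF u] closed
      alpha_act_inj[OF tinverses_flip[OF tinverses_sym[OF F]]])
  moreover have "beta_act (beta_act \<beta> Q) (flip H F) * u = inv \<S> (beta_act \<beta> F) \<longleftrightarrow>
      beta_act \<beta> Q * u = inv \<S> \<beta>"
  proof -
    have inj: "inv \<S> a = inv \<S> b \<longleftrightarrow> a = b" for a b by (metis antipode_inv(1))
    have "beta_act (beta_act \<beta> Q) (flip H F) * u = inv \<S> (beta_act \<beta> F) \<longleftrightarrow>
        \<S> (beta_act \<beta> Q * u) = \<beta>"
      by (simp add: beta_act_flip[OF u] closed inj beta_act_inj[OF F])
    then show ?thesis by (metis antipode_inv)
  qed
  ultimately show ?thesis
    using True by (simp add: is_u_operator_def T a b alpha_by_eq[OF F] alpha_by_eq[OF Q] beta_by_eq)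
next
  case False
  then show ?thesis unfolding is_u_operator_def twist_simps by blast
qed

lemma u_operator_twist:
  assumes "tinvertible H 2 F" "tinvertible H 2 Q"
  shows "u_operator (twist H F) (twist_R H F Q) = u_operator H Q"
  using assms is_u_operator_twist_iff by (auto simp: u_operator_def tinvertible_iff)

end

text \<open>
  The second half is the first applied to \<open>(\<R>\<^sup>T)\<^sup>-\<^sup>1\<close>, which is again invertible.
\<close>

theorem theorem6:
  fixes H :: "('k::field, 'h::ring_1) quasi_hopf"
    and R F :: "('k, 'h) tensor"
  assumes "quasi_triangular_quasi_hopf_algebra H R"
    and "is_twist H F"
  shows "u_operator (twist H F) (twist_R H F R) = u_operator H R \<and>
         u_operator (twist H F) (R_tilde (twist H F) (twist_R H F R)) =
           u_operator H (R_tilde H R)"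
proof -
  interpret quasi_triangular_quasi_hopf_algebra H R by fact
  have F: "tinvertible H 2 F" using assms(2) by (simp add: is_twist_def)
  then obtain F' R' where F': "tinverses 2 F F'" and R': "tinverses 2 R R'"
    using R_invertible by (auto simp: tinvertible_iff)
  have tilde: "tinvertible H 2 (R_tilde H R)"
    unfolding R_tilde_def tinvertible_iff tinverses_tinv[OF tinverses_flip[OF R']]
    using tinverses_sym[OF tinverses_flip[OF R']] by blast
  show ?thesis
    using u_operator_twist[OF F R_invertible] u_operator_twist[OF F tilde]
    by (simp add: tensor_ops_twist R_tilde_twist_R[OF F' R'])
qed

end
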